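(* Let $\mathcal{M}\subset\mathbb{R}^4$ be the body, $\pi:\mathbb{R}^4\to H_E$ the orthogonal projection, and $\mathcal{E}\subset H_E$ the union of six elliptical arcs, all as defined in the context. Then $\pi(\mathcal{M})$ is the intersection of all $3$-dimensional unit balls centered at points of $\mathcal{E}$; that is, $$\pi(\mathcal{M})=\bigcap_{p\in\mathcal{E}}\mathcal{B}^3(p,1),$$ where $\mathcal{B}^3(p,1)$ denotes the closed $3$-dimensional ball of radius $1$ centered at $p$ in the subspace $H_E$.
   Context: Let $A,B,C,D,E\in\mathbb{R}^4$ be the vertices of a regular $4$-simplex with side length $1$, placed so that the vectors $A,B,C,D$ form an orthogonal basis of $\mathbb{R}^4$, each of norm $1/\sqrt{2}$, and $E=\frac{\varphi}{2}(A+B+C+D)$, where $\varphi=\frac{1+\sqrt5}{2}$. $\mathcal{B}(x,r)$ is the closed ball and $\mathcal{S}(x,r)$ the sphere (boundary of $\mathcal{B}(x,r)$) of radius $r$ centered at $x$ in $\mathbb{R}^4$; $\operatorname{pos}(T)$ is the positive cone (set of all linear combinations with non-negative coefficients) of $T$; $M_{Z,W}$ is the midpoint of $Z$ and $W$. For distinct $X,Y\in\{A,B,C,D\}$, with $\{Z,W\}=\{A,B,C,D\}\setminus\{X,Y\}$, let $$\mathcal{F}_{X,Y}=\operatorname{pos}(\{X,Y,E\})\cap\mathcal{S}(M_{Z,W},\sqrt{3}/2).$$ Define $$\mathcal{M}_0=\bigcup_{X\ne Y\in\{A,B,C,D\}}\mathcal{F}_{X,Y},\qquad \mathcal{M}=\bigcap_{P\in\mathcal{M}_0}\mathcal{B}(P,1).$$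 For distinct $X,Y\in\{A,B,C,D\}$ let $S_{X,Y}=\mathcal{F}_{X,Y}\cap\operatorname{span}(\{X,Y\})$, which is the circular arc $\{\cos(t)X+\sin(t)Y: t\in[0,\pi/2]\}$. Let $H_E$ be the $3$-dimensional linear subspace of $\mathbb{R}^4$ orthogonal to $E$, and $\pi:\mathbb{R}^4\to H_E$ the orthogonal projection. Put $\mathcal{E}_{X,Y}=\pi(S_{X,Y})$ (an arc of an ellipse in $H_E$) and $$\mathcal{E}=\bigcup_{X\neq Y\in\{A,B,C,D\}}\mathcal{E}_{X,Y}.$$ *)

theory Defs
  imports "HOL-Analysis.Analysis"
begin

definition golden_ratio :: real where
  "golden_ratio = (1 + sqrt 5) / 2"

definition simplex_placement ::
    "real ^ 4 \<Rightarrow> real ^ 4 \<Rightarrow> real ^ 4 \<Rightarrow> real ^ 4 \<Rightarrow> real ^ 4 \<Rightarrow> bool" where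
  "simplex_placement A B C D E \<longleftrightarrow>
     distinct [A, B, C, D, E] \<and>
     pairwise (\<lambda>P Q. dist P Q = 1) {A, B, C, D, E} \<and>
     pairwise orthogonal {A, B, C, D} \<and>
     independent {A, B, C, D} \<and> span {A, B, C, D} = UNIV \<and>
     (\<forall>P\<in>{A, B, C, D}. norm P = 1 / sqrt 2) \<and>
     E = (golden_ratio / 2) *\<^sub>R (A + B + C + D)"

definition pos :: "'a::real_vector set \<Rightarrow> 'a set" where
  "pos T = {\<Sum>x\<in>F. c x *\<^sub>R x | F c. finite F \<and> F \<subseteq> T \<and> (\<forall>x\<in>F. 0 \<le> c x)}"

text \<open>In the following definitions \<open>V\<close> is the set \<open>{A, B, C, D}\<close>. The arguments \<open>Z\<close>, \<open>W\<close> of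
  \<open>face\<close> and \<open>circ_arc\<close> are the two elements of \<open>V - {X, Y}\<close>; their order is irrelevant.\<close>

definition face :: "real ^ 4 \<Rightarrow> real ^ 4 \<Rightarrow> real ^ 4 \<Rightarrow> real ^ 4 \<Rightarrow> real ^ 4 \<Rightarrow> (real ^ 4) set" where
  "face E X Y Z W = pos {X, Y, E} \<inter> sphere (midpoint Z W) (sqrt 3 / 2)"

definition body_centers :: "(real ^ 4) set \<Rightarrow> real ^ 4 \<Rightarrow> (real ^ 4) set" where
  "body_centers V E =
     \<Union>{face E X Y Z W | X Y Z W. X \<in> V \<and> Y \<in> V \<and> X \<noteq> Y \<and> {Z, W} = V - {X, Y}}"

definition body :: "(real ^ 4) set \<Rightarrow> real ^ 4 \<Rightarrow> (real ^ 4) set" where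
  "body V E = (\<Inter>P\<in>body_centers V E. cball P 1)"

definition circ_arc ::
    "real ^ 4 \<Rightarrow> real ^ 4 \<Rightarrow> real ^ 4 \<Rightarrow> real ^ 4 \<Rightarrow> real ^ 4 \<Rightarrow> (real ^ 4) set" where
  "circ_arc E X Y Z W = face E X Y Z W \<inter> span {X, Y}"

definition orth_hyperplane :: "'a::real_inner \<Rightarrow> 'a set" where
  "orth_hyperplane E = {x. orthogonal E x}"

text \<open>Orthogonal projection onto a subspace \<open>H\<close>; the description is unique for subspaces of a
  Euclidean space.\<close>

definition orth_proj :: "'a::real_inner set \<Rightarrow> 'a \<Rightarrow> 'a" where
  "orth_proj H x = (THE y. y \<in> H \<and> (\<forall>z\<in>H. orthogonal (x - y) z))"

definition elliptic_arcs :: "(real ^ 4) set \<Rightarrow> real ^ 4 \<Rightarrow> (real ^ 4) set" where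
  "elliptic_arcs V E =
     \<Union>{orth_proj (orth_hyperplane E) ` circ_arc E X Y Z W | X Y Z W.
        X \<in> V \<and> Y \<in> V \<and> X \<noteq> Y \<and> {Z, W} = V - {X, Y}}"

lemma pos_eq_convex_cone_hull: "pos T = convex_cone hull T"
proof
  show "pos T \<subseteq> convex_cone hull T"
  proof
    fix y assume "y \<in> pos T"
    then obtain F c where y: "y = (\<Sum>x\<in>F. c x *\<^sub>R x)"
      and F: "finite F" "F \<subseteq> T" "\<forall>x\<in>F. 0 \<le> c x"
      unfolding pos_def by blast
    have "(\<Sum>x\<in>F. c x *\<^sub>R x) \<in> convex_cone hull T"
      using F
    proof (induction F)
      case empty
      show ?case by (simp add: convex_cone_hull_contains_0)
    next
      case (insert a F)
      have "c a *\<^sub>R a \<in> convex_cone hull T"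
        using insert.prems by (intro convex_cone_hull_mul hull_inc) auto
      moreover have "(\<Sum>x\<in>F. c x *\<^sub>R x) \<in> convex_cone hull T"
        using insert by simp
      ultimately show ?case
        using insert.hyps by (simp add: convex_cone_hull_add)
    qed
    then show "y \<in> convex_cone hull T" by (simp add: y)
  qed
  have sub: "T \<subseteq> pos T"
  proof
    fix x assume "x \<in> T"
    then show "x \<in> pos T"
      unfolding pos_def
      by (intro CollectI exI[of _ "{x}"] exI[of _ "\<lambda>_. 1"]) simp
  qed
  have zero: "0 \<in> pos T"
    unfolding pos_def by (intro CollectI exI[of _ "{}"]) simp
  have add: "x + y \<in> pos T" if "x \<in> pos T" "y \<in> pos T" for x y
  proof -
    obtain F c where x: "x = (\<Sum>u\<in>F. c u *\<^sub>R u)"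
      and F: "finite F" "F \<subseteq> T" "\<forall>u\<in>F. 0 \<le> c u"
      using \<open>x \<in> pos T\<close> unfolding pos_def by blast
    obtain G d where y: "y = (\<Sum>u\<in>G. d u *\<^sub>R u)"
      and G: "finite G" "G \<subseteq> T" "\<forall>u\<in>G. 0 \<le> d u"
      using \<open>y \<in> pos T\<close> unfolding pos_def by blast
    define e where "e u = (if u \<in> F then c u else 0) + (if u \<in> G then d u else 0)" for u
    have x': "x = (\<Sum>u\<in>F \<union> G. (if u \<in> F then c u else 0) *\<^sub>R u)"
      unfolding x using F G by (intro sum.mono_neutral_cong_left) auto
    have y': "y = (\<Sum>u\<in>F \<union> G. (if u \<in> G then d u else 0) *\<^sub>R u)"
      unfolding y using F G by (intro sum.mono_neutral_cong_left) auto
    have "x + y = (\<Sum>u\<in>F \<union> G. e u *\<^sub>R u)"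
      unfolding x' y' e_def by (simp only: sum.distrib scaleR_add_left)
    moreover have "\<forall>u\<in>F \<union> G. 0 \<le> e u" using F G by (simp add: e_def)
    ultimately show ?thesis
      unfolding pos_def using F G by blast
  qed
  have mul: "a *\<^sub>R x \<in> pos T" if "x \<in> pos T" "0 \<le> a" for x a
  proof -
    obtain F c where x: "x = (\<Sum>u\<in>F. c u *\<^sub>R u)"
      and F: "finite F" "F \<subseteq> T" "\<forall>u\<in>F. 0 \<le> c u"
      using \<open>x \<in> pos T\<close> unfolding pos_def by blast
    show ?thesis
      unfolding pos_def using F \<open>0 \<le> a\<close>
      by (intro CollectI exI[of _ F] exI[of _ "\<lambda>u. a * c u"]) (simp add: x scaleR_sum_right)
  qed
  have "convex_cone (pos T)"
    unfolding convex_cone_iff using zero add mul by auto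
  then show "convex_cone hull T \<subseteq> pos T"
    using sub by (intro hull_minimal)
qed

lemma orth_proj_orth_hyperplane:
  "orth_proj (orth_hyperplane E) x = x - ((x \<bullet> E) / (E \<bullet> E)) *\<^sub>R E"
proof -
  define p where "p = x - ((x \<bullet> E) / (E \<bullet> E)) *\<^sub>R E"
  have p: "p \<in> orth_hyperplane E" "\<forall>z\<in>orth_hyperplane E. orthogonal (x - p) z"
    by (auto simp: p_def orth_hyperplane_def orthogonal_def inner_diff_right inner_commute)
  have "y = p" if y: "y \<in> orth_hyperplane E" "\<forall>z\<in>orth_hyperplane E. orthogonal (x - y) z" for y
  proof -
    have d: "y - p \<in> orth_hyperplane E"
      using y(1) p(1) by (simp add: orth_hyperplane_def orthogonal_def inner_diff_right)
    have "(x - p) \<bullet> (y - p) = 0" "(x - y) \<bullet> (y - p) = 0"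
      using y(2) p(2) d unfolding orthogonal_def by blast+
    then have "(y - p) \<bullet> (y - p) = 0" by (simp add: inner_diff_left)
    then show "y = p" by simp
  qed
  with p have "orth_proj (orth_hyperplane E) x = p"
    unfolding orth_proj_def by (intro the_equality conjI) blast+
  then show ?thesis by (simp add: p_def)
qed

lemma ex_simplex_placement: "\<exists>A B C D E. simplex_placement A B C D E"
proof -
  define s where "s = 1 / sqrt (2::real)"
  have s: "s * s = 1/2" "s > 0" by (auto simp: s_def)
  define v :: "4 \<Rightarrow> real ^ 4" where "v i = axis i s" for i
  define E where "E = (golden_ratio / 2) *\<^sub>R (v 1 + v 2 + v 3 + v 4)"
  have ip: "v i \<bullet> v j = (if i = j then 1/2 else 0)" for i j
    by (simp add: v_def inner_axis_axis s)
  have n4: "(1::4) \<noteq> 2" "(1::4) \<noteq> 3" "(1::4) \<noteq> 4" "(2::4) \<noteq> 3" "(2::4) \<noteq> 4" "(3::4) \<noteq> 4"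
    by simp_all
  note n4' = n4 n4[symmetric]
  have nrm: "norm (v i) = 1 / sqrt 2" for i
    by (simp add: norm_eq_sqrt_inner ip real_sqrt_divide)
  have dij: "dist (v i) (v j) = 1" if "i \<noteq> j" for i j
    using that by (simp add: dist_norm norm_eq_sqrt_inner inner_diff_left inner_diff_right ip)
  have g: "golden_ratio * golden_ratio = golden_ratio + 1"
    by (simp add: golden_ratio_def field_simps)
  have vE: "v i \<bullet> E = golden_ratio / 4" for i
    using exhaust_4[of i] by (auto simp: E_def inner_add_right ip n4')
  have EE: "E \<bullet> E = golden_ratio / 2 + 1 / 2"
    by (subst (1) E_def) (simp add: inner_add_left vE g field_simps)
  have dE: "dist (v i) E = 1" for i
  proof -
    have "(v i - E) \<bullet> (v i - E) = v i \<bullet> v i - 2 * (v i \<bullet> E) + E \<bullet> E"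
      by (simp add: inner_diff_left inner_diff_right inner_commute)
    also have "\<dots> = 1" by (simp add: ip vE EE)
    finally show ?thesis by (simp only: dist_norm norm_eq_sqrt_inner real_sqrt_one)
  qed
  have dE': "dist E (v i) = 1" for i
    using dE[of i] by (simp add: dist_commute)
  have dij': "dist (v i) (v j) = 1" if "v i \<noteq> v j" for i j
    by (rule dij) (use that in auto)
  have neq: "v i \<noteq> v j" if "i \<noteq> j" for i j using dij[OF that] by auto
  have v0: "0 \<noteq> v i" for i using nrm[of i] by auto
  have neqE: "v i \<noteq> E" for i using dE[of i] by auto
  let ?V = "{v 1, v 2, v 3, v 4}"
  have dist: "distinct [v 1, v 2, v 3, v 4, E]"
    by (simp add: neq neqE n4)
  have orth: "pairwise orthogonal ?V"
    unfolding pairwise_def orthogonal_def by (auto simp: ip)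
  have "0 \<notin> ?V" using v0 by auto
  with orth have ind: "independent ?V" by (rule pairwise_orthogonal_independent)
  have card: "card ?V = 4" using dist by simp
  have "UNIV \<subseteq> span ?V"
    by (rule card_ge_dim_independent) (use ind card in auto)
  then have span: "span ?V = UNIV" by blast
  have "pairwise (\<lambda>P Q. dist P Q = 1) {v 1, v 2, v 3, v 4, E}"
    unfolding pairwise_def using dij' dE dE' by auto
  then have "simplex_placement (v 1) (v 2) (v 3) (v 4) E"
    unfolding simplex_placement_def using dist orth ind span nrm E_def by blast
  then show ?thesis by blast
qed

end

(*
One inclusion holds because the arcs lie on the face surfaces and the projection is a contraction.
For the other, write q_v = 2 (q . v) for v in V = {A, B, C, D}, and S for the sum of V. A point q
is within distance 1 of c X + s Y with c^2 + s^2 = 1 iff K <= c q_X + s q_Y, where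
K = (sum of q_v^2 - 1) / 2. A centre in a face has the form P = a X + b Y + d S with a, b, d >= 0,
its sphere equation forces |P|^2 = 1/2 + d and a^2 + b^2 <= 1, and |q - P| <= 1 reads
K <= a q_X + b q_Y + d (sum of q_v - 1). Hence it suffices to lift a point x of the hyperplane to
q = x + t S with 4 t = sum of q_v >= 1 and K <= a q_X + b q_Y on the whole quarter disc a^2 + b^2 <= 1.
Only the two smallest coordinates of x matter. If the second smallest is at least -1/4, then
t = 1/4 works. Otherwise t is chosen as the height at which q touches the ball around a point
c X + s Y whose projected ball constrains x most, which makes (q_X, q_Y) a nonpositive multiple
of (c, s).
*)
theory Submission
  imports Defs
begin

section \<open>Scalar inequalities: choosing the height \<open>t\<close> of the lift\<close>

lemma sum_power2_le_power2_sum: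
  fixes f :: "'a \<Rightarrow> real"
  assumes "finite V" "\<And>v. v \<in> V \<Longrightarrow> 0 \<le> f v"
  shows "(\<Sum>v\<in>V. (f v)\<^sup>2) \<le> (\<Sum>v\<in>V. f v)\<^sup>2"
proof -
  have "(\<Sum>v\<in>V. (f v)\<^sup>2) \<le> (\<Sum>v\<in>V. f v * (\<Sum>w\<in>V. f w))"
    unfolding power2_eq_square
    by (intro sum_mono mult_left_mono member_le_sum) (use assms in auto)
  also have "\<dots> = (\<Sum>v\<in>V. f v)\<^sup>2"
    by (simp add: power2_eq_square sum_distrib_right)
  finally show ?thesis .
qed

text \<open>With \<open>t = (c + s) / 4\<close>, the conclusion says that \<open>(h1 + t, h2 + t) = - r (c, s)\<close>; this is the
  first-order condition for \<open>(c, s)\<close> to minimise \<open>2 (c h1 + s h2) + (c + s)\<^sup>2 / 4\<close> on the circle.\<close>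
lemma arc_contact_direction:
  fixes h1 h2 :: real
  assumes le: "h1 \<le> h2" and h2: "h2 < - (1/4)"
  obtains c s r where "0 \<le> c" "0 \<le> s" "c\<^sup>2 + s\<^sup>2 = 1" "0 \<le> r"
    "h1 = - ((c + s) / 4) - r * c" "h2 = - ((c + s) / 4) - r * s"
proof (cases "h1 = h2")
  \<comment> \<open>Equality is treated apart: the root \<open>t = - h2\<close> of the function
    \<open>f\<close> used below would then yield the zero vector, which has no direction.\<close>
  case True
  show thesis
  proof (cases "- 4 * h2 \<le> sqrt 2")
    case small: True
    \<comment> \<open>With \<open>r = 0\<close> only \<open>c + s = g\<close> on the unit circle is
      left, solved by \<open>(g + w) / 2\<close> and \<open>(g - w) / 2\<close>. The bound
      \<open>g <= sqrt 2\<close> makes \<open>w\<close> real, and \<open>1 <= g\<close> makes both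
      solutions nonnegative.\<close>
    define g where "g = - 4 * h2"
    have g: "1 \<le> g" "g \<le> sqrt 2" using h2 small by (auto simp: g_def)
    have g2: "1 \<le> g\<^sup>2" "g\<^sup>2 \<le> 2"
      using g power_mono[OF g(1), of 2] power_mono[OF g(2), of 2] by auto
    define w where "w = sqrt (2 - g\<^sup>2)"
    have w: "0 \<le> w" "w\<^sup>2 = 2 - g\<^sup>2" using g2 by (auto simp: w_def)
    have "w \<le> g" by (rule power2_le_imp_le) (use w g g2 in auto)
    have "((g + w) / 2)\<^sup>2 + ((g - w) / 2)\<^sup>2 = (g\<^sup>2 + w\<^sup>2) / 2"
      by (simp add: power2_eq_square field_simps)
    with w have "((g + w) / 2)\<^sup>2 + ((g - w) / 2)\<^sup>2 = 1" by simp
    moreover have "h2 = - (((g + w) / 2 + (g - w) / 2) / 4)"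
      by (simp add: g_def field_simps)
    ultimately show thesis
      using True w g \<open>w \<le> g\<close> by (intro that[of "(g + w) / 2" "(g - w) / 2" 0]) auto
  next
    case False
    \<comment> \<open>Here \<open>- 4 * h2\<close> exceeds \<open>sqrt 2\<close>, the maximum of
      \<open>c + s\<close> on the circle, so the symmetric point is taken and \<open>r\<close> is
      solved from \<open>h2 = - c / 2 - r * c\<close>.\<close>
    define c where "c = sqrt 2 / 2"
    have c: "c\<^sup>2 = 1 / 2" "0 < c" "c * sqrt 2 = 1" by (auto simp: c_def power_divide)
    define r where "r = sqrt 2 * (- h2 - sqrt 2 / 4)"
    have "0 \<le> r" using False by (simp add: r_def)
    moreover have "r * c = (c * sqrt 2) * (- h2 - sqrt 2 / 4)"
      unfolding r_def by (simp add: algebra_simps)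
    then have "r * c = - h2 - c / 2" by (simp add: c(3)) (simp add: c_def)
    ultimately show thesis
      using True c by (intro that[of c c r]) auto
  qed
next
  case False
  \<comment> \<open>A zero of \<open>f\<close> is a height \<open>t\<close> at which the unit vector
    along \<open>- (h1 + t, h2 + t)\<close> has coordinate sum \<open>4 * t\<close>. At
    \<open>1/4\<close> both coordinates are negative, so \<open>f\<close> compares their Euclidean
    norm with their absolute sum. Stopping at \<open>- h2\<close> keeps both coordinates
    nonpositive.\<close>
  define f where "f t = - (h1 + t) - (h2 + t) - 4 * t * sqrt ((h1 + t)\<^sup>2 + (h2 + t)\<^sup>2)" for t
  have "0 \<le> f (1/4)"
  proof -
    have "sqrt ((h1 + 1/4)\<^sup>2 + (h2 + 1/4)\<^sup>2) \<le> - (h1 + 1/4) - (h2 + 1/4)"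
    proof (rule real_le_lsqrt)
      have "0 \<le> (h1 + 1/4) * (h2 + 1/4)"
        by (rule mult_nonpos_nonpos) (use le h2 in auto)
      then show "(h1 + 1/4)\<^sup>2 + (h2 + 1/4)\<^sup>2 \<le> (- (h1 + 1/4) - (h2 + 1/4))\<^sup>2"
        by (simp add: power2_eq_square algebra_simps)
    qed (use le h2 in auto)
    then show ?thesis by (simp add: f_def)
  qed
  moreover have "f (- h2) \<le> 0"
  proof -
    have "f (- h2) = (h2 - h1) * (1 + 4 * h2)"
      using le by (simp add: f_def algebra_simps)
    also have "\<dots> \<le> 0"
      by (rule mult_nonneg_nonpos) (use le h2 in auto)
    finally show ?thesis .
  qed
  moreover have "continuous_on {1/4..- h2} f"
    unfolding f_def by (intro continuous_intros)
  ultimately obtain t where t: "1/4 \<le> t" "t \<le> - h2" "f t = 0"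
    using IVT2'[of f "- h2" 0 "1/4"] h2 by auto
  define r where "r = sqrt ((h1 + t)\<^sup>2 + (h2 + t)\<^sup>2)"
  have neg: "h1 + t < 0" "h2 + t \<le> 0" using t le False by auto
  then have "0 < (h1 + t)\<^sup>2 + (h2 + t)\<^sup>2"
    by (simp add: sum_power2_gt_zero_iff)
  then have r: "0 < r" "r\<^sup>2 = (h1 + t)\<^sup>2 + (h2 + t)\<^sup>2" by (auto simp: r_def)
  have tr: "- (h1 + t) - (h2 + t) = 4 * t * r"
    using t(3) by (simp add: f_def r_def)
  define c s where "c = - (h1 + t) / r" and "s = - (h2 + t) / r"
  have rc: "r * c = - (h1 + t)" "r * s = - (h2 + t)" using r(1) by (auto simp: c_def s_def)
  have "c\<^sup>2 + s\<^sup>2 = ((h1 + t)\<^sup>2 + (h2 + t)\<^sup>2) / r\<^sup>2"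
    by (simp only: c_def s_def power_divide power2_minus add_divide_distrib)
  then have "c\<^sup>2 + s\<^sup>2 = 1" using r(1) by (simp flip: r(2))
  moreover have "c + s = 4 * t"
  proof -
    have "r * (c + s) = r * (4 * t)" using rc tr by (simp add: algebra_simps)
    with r(1) show ?thesis by simp
  qed
  moreover have "0 \<le> c" "0 \<le> s"
    using r(1) neg by (auto simp: c_def s_def divide_nonneg_pos)
  ultimately show thesis
    using r(1) rc by (intro that[of c s r]) auto
qed

lemma finite_obtains_minimizer:
  fixes f :: "'a \<Rightarrow> 'b::linorder"
  assumes "finite V" "V \<noteq> {}"
  obtains u where "u \<in> V" "\<And>v. v \<in> V \<Longrightarrow> f u \<le> f v"
proof -
  have "Min (f ` V) \<in> f ` V" using assms by simp
  then obtain u where "u \<in> V" "Min (f ` V) = f u" by blast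
  moreover have "Min (f ` V) \<le> f v" if "v \<in> V" for v using assms that by simp
  ultimately show thesis using that by simp
qed

text \<open>Here \<open>h v\<close> stands for \<open>2 * (x . v)\<close> with \<open>x\<close> in
  the hyperplane; \<open>arc\<close> says that \<open>x\<close> is within distance 1 of the
  projected arcs, and \<open>h v + t\<close> are the coordinates of the lift, with square sum
  \<open>H + 4 * t^2\<close> because \<open>h\<close> sums to 0. Up to a swap, every pair
  \<open>X\<close>, \<open>Y\<close> dominates the two smallest values \<open>h u\<close>,
  \<open>h w\<close> coordinatewise, so only these decide \<open>t\<close>.\<close>

lemma lift_satisfying_arc_bounds:
  fixes h :: "'a \<Rightarrow> real"
  assumes card: "card V = 4" and sum0: "(\<Sum>v\<in>V. h v) = 0"
  defines "H \<equiv> \<Sum>v\<in>V. (h v)\<^sup>2"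
  assumes arc: "\<And>X Y c s. \<lbrakk>X \<in> V; Y \<in> V; X \<noteq> Y; 0 \<le> c; 0 \<le> s; c\<^sup>2 + s\<^sup>2 = 1\<rbrakk>
    \<Longrightarrow> H - 1 \<le> 2 * (c * h X + s * h Y) + (c + s)\<^sup>2 / 4"
  obtains t where "1/4 \<le> t"
    "\<And>X Y x y. \<lbrakk>X \<in> V; Y \<in> V; X \<noteq> Y; 0 \<le> x; 0 \<le> y; x\<^sup>2 + y\<^sup>2 \<le> 1\<rbrakk>
    \<Longrightarrow> (H + 4 * t\<^sup>2 - 1) / 2 \<le> x * (h X + t) + y * (h Y + t)"
proof -
  have fin: "finite V" using card by (simp add: card_ge_0_finite)
  have "V \<noteq> {}" using card by auto
  with fin obtain u where u: "u \<in> V" "\<And>v. v \<in> V \<Longrightarrow> h u \<le> h v"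
    using finite_obtains_minimizer[of V h] by blast
  have "card (V - {u}) = 3" using card u(1) by simp
  then have "V - {u} \<noteq> {}" by (metis card.empty zero_neq_numeral)
  moreover have "finite (V - {u})" using fin by simp
  ultimately obtain w where w: "w \<in> V - {u}" "\<And>v. v \<in> V - {u} \<Longrightarrow> h w \<le> h v"
    using finite_obtains_minimizer[of "V - {u}" h] by blast
  have huw: "h u \<le> h w" using u w by auto
  show thesis
  proof (cases "h w < - (1/4)")
    case False
    \<comment> \<open>The arc condition at the endpoint \<open>u\<close> itself.\<close>
    have H1: "H \<le> 5/4 + 2 * h u"
      using arc[of u w 1 0] u w by auto
    \<comment> \<open>Shifting by the minimum makes all terms nonnegative; since \<open>h\<close>
      sums to 0, the shifted sum is \<open>- 4 * h u\<close>.\<close>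
    have "(\<Sum>v\<in>V. (h v - h u)\<^sup>2) \<le> (\<Sum>v\<in>V. h v - h u)\<^sup>2"
      by (rule sum_power2_le_power2_sum) (use fin u in auto)
    moreover have "(\<Sum>v\<in>V. (h v - h u)\<^sup>2) = H + 4 * (h u)\<^sup>2"
      by (simp add: H_def power2_diff sum.distrib sum_subtractf card sum0
          flip: sum_distrib_left sum_distrib_right)
    ultimately have H2: "H \<le> 12 * (h u)\<^sup>2"
      by (simp add: sum_subtractf sum0 card power_mult_distrib)
    \<comment> \<open>The two bounds meet at \<open>h u = - 1/4\<close>: below it \<open>H1\<close>
      suffices, and between it and 0 \<open>H2\<close> does.\<close>
    have H3: "H \<le> 3/4"
    proof (cases "h u < - (1/4)")
      case False
      have "h u \<le> 0"
      proof (rule ccontr)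
        assume "\<not> h u \<le> 0"
        then have "0 < (\<Sum>v\<in>V. h v)"
          using u \<open>V \<noteq> {}\<close> fin by (intro sum_pos) force+
        with sum0 show False by simp
      qed
      with False have "(h u)\<^sup>2 \<le> (1/4)\<^sup>2" by (intro abs_le_square_iff[THEN iffD1]) auto
      with H2 show ?thesis by (simp add: power2_eq_square)
    qed (use H1 in simp)
    \<comment> \<open>The left side of the required bound at \<open>t = 1/4\<close>.\<close>
    define k where "k = (H - 3/4) / 2"
    have k: "k \<le> 0" "k \<le> h u + 1/4" using H1 H3 by (auto simp: k_def)
    \<comment> \<open>Only the coordinate at \<open>u\<close> can be negative after the lift. It is
      at least \<open>k\<close>, and its weight \<open>x\<close> is at most 1, which does not spoil
      the bound because \<open>k <= 0\<close>.\<close>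
    have single: "k \<le> x * (h X + 1/4) + y * (h Y + 1/4)"
      if "X \<in> V" "Y \<in> V" "X \<noteq> Y" "0 \<le> x" "0 \<le> y" "x\<^sup>2 + y\<^sup>2 \<le> 1" "Y \<noteq> u" for X Y x y
    proof -
      have "x\<^sup>2 \<le> 1\<^sup>2"
        unfolding one_power2 using that(6) zero_le_power2[of y] by linarith
      then have "x \<le> 1" by (rule power2_le_imp_le) simp
      then have "k \<le> x * k" using k(1) mult_right_mono_neg[of x 1 k] by simp
      also have "\<dots> \<le> x * (h X + 1/4)"
        using k u(2)[OF that(1)] that by (intro mult_left_mono) auto
      also have "\<dots> \<le> x * (h X + 1/4) + y * (h Y + 1/4)"
        using False w(2)[of Y] that by simp
      finally show ?thesis .
    qed
    have "k \<le> x * (h X + 1/4) + y * (h Y + 1/4)"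
      if "X \<in> V" "Y \<in> V" "X \<noteq> Y" "0 \<le> x" "0 \<le> y" "x\<^sup>2 + y\<^sup>2 \<le> 1" for X Y x y
      using single[OF that] single[of Y X y x] that by (cases "Y = u") (auto simp: add.commute)
    then show thesis
      by (intro that[of "1/4"]) (auto simp: k_def power2_eq_square)
  next
    case True
    from arc_contact_direction[OF huw True] obtain c s r where
      cs: "0 \<le> c" "0 \<le> s" "c\<^sup>2 + s\<^sup>2 = 1" "0 \<le> r"
        "h u = - ((c + s) / 4) - r * c" "h w = - ((c + s) / 4) - r * s" .
    define t where "t = (c + s) / 4"
    have hu: "h u + t = - r * c" "h w + t = - r * s" using cs by (auto simp: t_def)
    have "1\<^sup>2 \<le> (c + s)\<^sup>2" using cs by (simp add: power2_sum)
    then have "1 \<le> c + s" by (rule power2_le_imp_le) (use cs in auto)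
    then have t: "1/4 \<le> t" by (simp add: t_def)
    \<comment> \<open>At the contact direction the arc condition bounds the required left side by
      exactly \<open>- r\<close>.\<close>
    have "H - 1 \<le> 2 * (c * h u + s * h w) + (c + s)\<^sup>2 / 4"
      using arc[of u w c s] u w cs by auto
    also have "\<dots> = 2 * (- r * (c\<^sup>2 + s\<^sup>2)) - 4 * t\<^sup>2"
      unfolding cs(5,6) t_def by (simp add: power2_eq_square field_simps)
    finally have k: "(H + 4 * t\<^sup>2 - 1) / 2 \<le> - r" using cs(3) by simp
    \<comment> \<open>The lifted pair at \<open>u\<close>, \<open>w\<close> is \<open>- r\<close>
      times the unit vector \<open>(c, s)\<close>, so by Cauchy-Schwarz its product with any vector
      of the unit disc is at least \<open>- r\<close>; other pairs are larger
      coordinatewise.\<close>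
    have ordered: "- r \<le> x * (h X + t) + y * (h Y + t)"
      if "X \<in> V" "Y \<in> V" "X \<noteq> Y" "0 \<le> x" "0 \<le> y" "x\<^sup>2 + y\<^sup>2 \<le> 1" "Y \<noteq> u" for X Y x y
    proof -
      have "c * x + s * y \<le> 1"
        using cs that sum_squares_bound[of c x] sum_squares_bound[of s y] by simp
      then have "- r \<le> - r * (c * x + s * y)"
        using cs(4) mult_left_mono[of "c * x + s * y" 1 r] by simp
      also have "\<dots> = x * (h u + t) + y * (h w + t)"
        unfolding hu by (simp add: algebra_simps)
      also have "\<dots> \<le> x * (h X + t) + y * (h Y + t)"
        using u(2)[of X] w(2)[of Y] that by (intro add_mono mult_left_mono) auto
      finally show ?thesis .
    qed
    have "- r \<le> x * (h X + t) + y * (h Y + t)"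
      if "X \<in> V" "Y \<in> V" "X \<noteq> Y" "0 \<le> x" "0 \<le> y" "x\<^sup>2 + y\<^sup>2 \<le> 1" for X Y x y
      using ordered[OF that] ordered[of Y X y x] that by (cases "Y = u") (auto simp: add.commute)
    then show thesis
      using t by (intro that[of t] order_trans[OF k])
  qed
qed

section \<open>Cones, the orthogonal frame and the projection\<close>

lemma pos_finite:
  assumes "finite T"
  shows "pos T = {\<Sum>x\<in>T. c x *\<^sub>R x | c. \<forall>x\<in>T. 0 \<le> c x}"
proof (intro equalityI subsetI)
  fix y assume "y \<in> pos T"
  then obtain F c where y: "y = (\<Sum>x\<in>F. c x *\<^sub>R x)" and F: "F \<subseteq> T" "\<forall>x\<in>F. 0 \<le> c x"
    unfolding pos_def by blast
  have "y = (\<Sum>x\<in>T. (if x \<in> F then c x else 0) *\<^sub>R x)"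
    unfolding y using F assms by (intro sum.mono_neutral_cong_left) auto
  then show "y \<in> {\<Sum>x\<in>T. c x *\<^sub>R x | c. \<forall>x\<in>T. 0 \<le> c x}"
    using F by (intro CollectI exI[of _ "\<lambda>x. if x \<in> F then c x else 0"]) auto
next
  fix y assume "y \<in> {\<Sum>x\<in>T. c x *\<^sub>R x | c. \<forall>x\<in>T. 0 \<le> c x}"
  then show "y \<in> pos T" unfolding pos_def using assms by blast
qed

lemma mem_pos3_iff:
  assumes "distinct [X, Y, E]"
  shows "P \<in> pos {X, Y, E} \<longleftrightarrow>
    (\<exists>x y e. P = x *\<^sub>R X + y *\<^sub>R Y + e *\<^sub>R E \<and> 0 \<le> x \<and> 0 \<le> y \<and> 0 \<le> e)" (is "?L \<longleftrightarrow> ?R")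
proof
  assume ?L
  then obtain c where "P = (\<Sum>x\<in>{X, Y, E}. c x *\<^sub>R x)" "\<forall>x\<in>{X, Y, E}. 0 \<le> c x"
    by (auto simp: pos_finite)
  with assms show ?R
    by (intro exI[of _ "c X"] exI[of _ "c Y"] exI[of _ "c E"]) (simp add: add.assoc)
next
  assume ?R
  then obtain x y e where P: "P = x *\<^sub>R X + y *\<^sub>R Y + e *\<^sub>R E" "0 \<le> x" "0 \<le> y" "0 \<le> e"
    by blast
  define c where "c v = (if v = X then x else if v = Y then y else e)" for v
  have "P = (\<Sum>v\<in>{X, Y, E}. c v *\<^sub>R v)" "\<forall>v\<in>{X, Y, E}. 0 \<le> c v"
    using assms P by (auto simp: c_def add.assoc)
  then show ?L by (auto simp: pos_finite)
qed

text \<open>The difference of the two sides is orthogonal to the spanning set \<open>V\<close>,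
  hence to itself. The factor 2 compensates for the squared norms 1/2.\<close>

lemma orthogonal_frame_expansion:
  fixes V :: "'a::euclidean_space set"
  assumes "finite V" "span V = UNIV"
    and frame: "\<And>v w. v \<in> V \<Longrightarrow> w \<in> V \<Longrightarrow> v \<bullet> w = (if v = w then 1/2 else 0)"
  shows "x = (\<Sum>v\<in>V. (2 * (x \<bullet> v)) *\<^sub>R v)"
proof -
  let ?y = "x - (\<Sum>v\<in>V. (2 * (x \<bullet> v)) *\<^sub>R v)"
  have "orthogonal ?y w" if "w \<in> V" for w
  proof -
    have "(\<Sum>v\<in>V. (2 * (x \<bullet> v)) *\<^sub>R v) \<bullet> w = (\<Sum>v\<in>V. if v = w then x \<bullet> w else 0)"
      unfolding inner_sum_left by (intro sum.cong) (use frame that in auto)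
    also have "\<dots> = x \<bullet> w" using that assms(1) by simp
    finally show ?thesis by (simp add: orthogonal_def inner_diff_left)
  qed
  moreover have "?y \<in> span V" using assms(2) by blast
  ultimately have "orthogonal ?y ?y" by (rule orthogonal_to_span[rotated])
  then show ?thesis by (simp add: orthogonal_def)
qed

lemma dist_orth_proj_orth_hyperplane_le:
  "dist (orth_proj (orth_hyperplane E) x) (orth_proj (orth_hyperplane E) y) \<le> dist x y"
proof (cases "E = 0")
  case False
  define z where "z = x - y"
  define k where "k = (z \<bullet> E) / (E \<bullet> E)"
  have k: "k * (E \<bullet> E) = z \<bullet> E" using False by (simp add: k_def)
  have "(norm (z - k *\<^sub>R E))\<^sup>2 = z \<bullet> z - 2 * k * (z \<bullet> E) + k * (k * (E \<bullet> E))"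
    unfolding power2_norm_eq_inner
    by (simp add: inner_diff_left inner_diff_right inner_commute algebra_simps)
  also have "\<dots> = z \<bullet> z - k\<^sup>2 * (E \<bullet> E)"
    by (simp add: power2_eq_square flip: k)
  also have "\<dots> \<le> (norm z)\<^sup>2" by (simp add: power2_norm_eq_inner)
  finally have "norm (z - k *\<^sub>R E) \<le> norm z" by (rule power2_le_imp_le) simp
  moreover have "orth_proj (orth_hyperplane E) x - orth_proj (orth_hyperplane E) y = z - k *\<^sub>R E"
    by (simp add: orth_proj_orth_hyperplane z_def k_def inner_diff_left diff_divide_distrib
        scaleR_diff_left)
  ultimately show ?thesis by (simp add: dist_norm z_def)
qed (simp add: orth_proj_orth_hyperplane)

lemma orth_proj_orth_hyperplane_mem:
  "orth_proj (orth_hyperplane E) x \<in> orth_hyperplane E"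
  unfolding orth_proj_orth_hyperplane
  by (simp add: orth_hyperplane_def orthogonal_def inner_diff_right inner_commute[of E x])

section \<open>Translation between the bodies and the scalar inequalities\<close>

theorem proposition5p1:
  fixes A B C D E :: "real ^ 4"
  assumes "simplex_placement A B C D E"
  shows "orth_proj (orth_hyperplane E) ` body {A, B, C, D} E =
    (\<Inter>p\<in>elliptic_arcs {A, B, C, D} E. cball p 1 \<inter> orth_hyperplane E)"
proof -
  define V where "V = {A, B, C, D}"
  define S where "S = A + B + C + D"
  define \<pi> where "\<pi> = orth_proj (orth_hyperplane E)"
  define g where "g = golden_ratio / 2"
  have g: "0 < g" by (simp add: g_def golden_ratio_def add_pos_nonneg)
  have dist: "distinct [A, B, C, D, E]" and orth: "pairwise orthogonal V"
    and span: "span V = UNIV" and nrm: "\<And>v. v \<in> V \<Longrightarrow> norm v = 1 / sqrt 2"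
    and E: "E = g *\<^sub>R S"
    using assms unfolding simplex_placement_def V_def S_def g_def by blast+
  have fin: "finite V" and card: "card V = 4" and EV: "E \<notin> V"
    using dist by (auto simp: V_def)
  have S: "S = (\<Sum>v\<in>V. v)" using dist by (simp add: V_def S_def add.assoc)
  have frame: "v \<bullet> w = (if v = w then 1/2 else 0)" if "v \<in> V" "w \<in> V" for v w
    using that orth nrm[of v]
    by (auto simp: pairwise_def orthogonal_def dot_square_norm power_divide)
  have expand: "x = (\<Sum>v\<in>V. (2 * (x \<bullet> v)) *\<^sub>R v)" for x
    by (rule orthogonal_frame_expansion[OF fin span frame])
  have SV: "S \<bullet> v = 1/2" "v \<bullet> S = 1/2" if "v \<in> V" for v
  proof -
    have "S \<bullet> v = (\<Sum>w\<in>V. if w = v then 1/2 else 0)"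
      unfolding S inner_sum_left by (intro sum.cong) (use frame that in auto)
    then show "S \<bullet> v = 1/2" using that fin by simp
    then show "v \<bullet> S = 1/2" by (simp add: inner_commute)
  qed
  have SS: "S \<bullet> S = 2"
  proof -
    have "S \<bullet> S = (\<Sum>v\<in>V. v \<bullet> S)" by (subst S) (simp add: inner_sum_left)
    then show ?thesis using SV card by simp
  qed
  have \<pi>: "\<pi> x = x - (x \<bullet> S / 2) *\<^sub>R S" for x
    using g by (simp add: \<pi>_def orth_proj_orth_hyperplane E SS)
  have complement: "\<exists>Z W. {Z, W} = V - {X, Y}" if "X \<in> V" "Y \<in> V" "X \<noteq> Y" for X Y
  proof -
    have "card (V - {X, Y}) = 2" using that fin card by (simp add: card_Diff_subset)
    then show ?thesis by (metis card_2_iff)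
  qed
  have ZW: "Z \<in> V" "W \<in> V" "Z \<noteq> W" "X \<noteq> Z" "X \<noteq> W" "Y \<noteq> Z" "Y \<noteq> W"
    if "X \<in> V" "Y \<in> V" "X \<noteq> Y" "{Z, W} = V - {X, Y}" for X Y Z W
  proof -
    have "card {Z, W} = 2" using that fin card by (simp add: card_Diff_subset)
    then show "Z \<noteq> W" by auto
  qed (use that in auto)
  have arc_mem: "\<pi> (c *\<^sub>R X + s *\<^sub>R Y) \<in> elliptic_arcs V E"
    if XY: "X \<in> V" "Y \<in> V" "X \<noteq> Y" and cs: "0 \<le> c" "0 \<le> s" "c\<^sup>2 + s\<^sup>2 = 1" for X Y c s
  proof -
    obtain Z W where zw: "{Z, W} = V - {X, Y}" using complement[OF XY] by blast
    note zw' = ZW[OF XY zw]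
    define P where "P = c *\<^sub>R X + s *\<^sub>R Y"
    \<comment> \<open>\<open>P\<close> is orthogonal to the midpoint; their squared norms are 1/2
      and 1/4.\<close>
    have "(dist (midpoint Z W) P)\<^sup>2 = 3/4"
      using zw' XY cs(3)
      unfolding dist_norm power2_norm_eq_inner P_def midpoint_def
      by (simp add: inner_add_left inner_add_right inner_diff_left inner_diff_right frame
          power2_eq_square)
    then have "(dist (midpoint Z W) P)\<^sup>2 = (sqrt 3 / 2)\<^sup>2" by (simp add: power_divide)
    then have P_sphere: "dist (midpoint Z W) P = sqrt 3 / 2"
      by (rule power2_eq_imp_eq) auto
    have "P = c *\<^sub>R X + s *\<^sub>R Y + 0 *\<^sub>R E" by (simp add: P_def)
    moreover have "distinct [X, Y, E]" using XY EV by auto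
    ultimately have "P \<in> pos {X, Y, E}"
      unfolding mem_pos3_iff[OF \<open>distinct [X, Y, E]\<close>] using cs by blast
    moreover have "P \<in> span {X, Y}"
      unfolding P_def by (intro span_add span_mul span_base) auto
    ultimately have "P \<in> circ_arc E X Y Z W" using P_sphere by (simp add: circ_arc_def face_def)
    then show ?thesis
      unfolding elliptic_arcs_def \<pi>_def P_def using XY zw by blast
  qed
  have "\<pi> ` body V E \<subseteq> (\<Inter>p\<in>elliptic_arcs V E. cball p 1 \<inter> orth_hyperplane E)"
  proof (intro subsetI INT_I IntI)
    fix x p assume x: "x \<in> \<pi> ` body V E" and p: "p \<in> elliptic_arcs V E"
    from x obtain q where q: "q \<in> body V E" "x = \<pi> q" by blast
    \<comment> \<open>Each arc is part of a face, so \<open>p\<close> is the projection of a centre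
      of the body.\<close>
    from p obtain P where P: "P \<in> body_centers V E" "p = \<pi> P"
      unfolding elliptic_arcs_def body_centers_def circ_arc_def \<pi>_def by blast
    have "dist P q \<le> 1" using q P by (auto simp: body_def)
    then show "x \<in> cball p 1"
      using dist_orth_proj_orth_hyperplane_le[of E P q] by (simp add: q P \<pi>_def)
    show "x \<in> orth_hyperplane E"
      by (simp add: q \<pi>_def orth_proj_orth_hyperplane_mem)
  qed
  moreover have "x \<in> \<pi> ` body V E"
    if x: "x \<in> (\<Inter>p\<in>elliptic_arcs V E. cball p 1 \<inter> orth_hyperplane E)" for x
  proof -
    \<comment> \<open>The intersection yields membership in the hyperplane only through some arc
      point; \<open>A\<close> supplies one.\<close>
    have "\<pi> (1 *\<^sub>R A + 0 *\<^sub>R B) \<in> elliptic_arcs V E"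
      by (rule arc_mem) (use dist in \<open>auto simp: V_def\<close>)
    with x have "x \<in> orth_hyperplane E" by blast
    then have xS: "x \<bullet> S = 0"
      using g by (simp add: orth_hyperplane_def orthogonal_def E inner_commute)
    define h where "h v = 2 * (x \<bullet> v)" for v
    define H where "H = (\<Sum>v\<in>V. (h v)\<^sup>2)"
    have xx: "x \<bullet> x = H / 2"
    proof -
      have "x \<bullet> x = (\<Sum>v\<in>V. (h v)\<^sup>2 / 2)"
        by (subst (2) expand) (simp add: inner_sum_right h_def power2_eq_square algebra_simps)
      then show ?thesis by (simp add: H_def sum_divide_distrib)
    qed
    have sum0: "(\<Sum>v\<in>V. h v) = 0"
      using xS by (simp add: h_def S inner_sum_right flip: sum_distrib_left)
    have arc: "H - 1 \<le> 2 * (c * h X + s * h Y) + (c + s)\<^sup>2 / 4"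
      if XY: "X \<in> V" "Y \<in> V" "X \<noteq> Y" and cs: "0 \<le> c" "0 \<le> s" "c\<^sup>2 + s\<^sup>2 = 1" for X Y c s
    proof -
      let ?P = "c *\<^sub>R X + s *\<^sub>R Y"
      have PS: "?P \<bullet> S = (c + s) / 2" using XY by (simp add: inner_add_left SV add_divide_distrib)
      have PP: "?P \<bullet> ?P = 1 / 2"
        using XY cs(3) by (simp add: inner_add_left inner_add_right frame power2_eq_square)
      have xP: "x \<bullet> ?P = (c * h X + s * h Y) / 2"
        by (simp add: h_def inner_add_right)
      have Sx: "S \<bullet> x = 0" using xS by (simp add: inner_commute)
      \<comment> \<open>Pythagoras: as \<open>x\<close> is orthogonal to \<open>S\<close>,
        projecting \<open>p\<close> removes just its \<open>S\<close> component from the squared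
        distance.\<close>
      have "(dist (\<pi> p) x)\<^sup>2 = x \<bullet> x - 2 * (x \<bullet> p) + p \<bullet> p - (p \<bullet> S)\<^sup>2 / 2" for p
        unfolding \<pi> dist_norm power2_norm_eq_inner
        by (simp add: inner_diff_left inner_diff_right SS xS Sx inner_commute[of S p]
            inner_commute[of p x] power2_eq_square)
      from this[of ?P]
      have "(dist (\<pi> ?P) x)\<^sup>2 = x \<bullet> x - 2 * (x \<bullet> ?P) + ?P \<bullet> ?P - (?P \<bullet> S)\<^sup>2 / 2" .
      moreover have "dist (\<pi> ?P) x \<le> 1" using x arc_mem[OF XY cs] by (blast dest: mem_cball[THEN iffD1])
      then have "(dist (\<pi> ?P) x)\<^sup>2 \<le> 1" by (simp add: power_le_one)
      ultimately show ?thesis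
        by (simp add: PS PP xP xx power_divide field_simps)
    qed
    obtain t where t: "1/4 \<le> t" and
      lift: "\<And>X Y a b. \<lbrakk>X \<in> V; Y \<in> V; X \<noteq> Y; 0 \<le> a; 0 \<le> b; a\<^sup>2 + b\<^sup>2 \<le> 1\<rbrakk>
        \<Longrightarrow> (H + 4 * t\<^sup>2 - 1) / 2 \<le> a * (h X + t) + b * (h Y + t)"
      using lift_satisfying_arc_bounds[OF card sum0 arc[unfolded H_def]] unfolding H_def by blast
    define q where "q = x + t *\<^sub>R S"
    have "q \<in> body V E"
      unfolding body_def
    proof (rule INT_I)
      fix P assume "P \<in> body_centers V E"
      then obtain X Y Z W where XY: "X \<in> V" "Y \<in> V" "X \<noteq> Y" and zw: "{Z, W} = V - {X, Y}"
        and P: "P \<in> pos {X, Y, E}" "dist (midpoint Z W) P = sqrt 3 / 2"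
        by (auto simp: body_centers_def face_def)
      note zw' = ZW[OF XY zw]
      have "distinct [X, Y, E]" using XY EV by auto
      then obtain a b e where P_eq: "P = a *\<^sub>R X + b *\<^sub>R Y + e *\<^sub>R E" and ab: "0 \<le> a" "0 \<le> b" "0 \<le> e"
        using P(1) mem_pos3_iff by metis
      define d where "d = e * g"
      have d: "0 \<le> d" using ab g by (simp add: d_def)
      have P_d: "P = a *\<^sub>R X + b *\<^sub>R Y + d *\<^sub>R S" by (simp add: P_eq d_def E)
      have PP1: "P \<bullet> P = (a\<^sup>2 + b\<^sup>2) / 2 + d * (a + b) + 2 * d\<^sup>2"
        using XY by (simp add: P_d inner_add_left inner_add_right frame SV SS power2_eq_square
            algebra_simps)
      have "P \<bullet> Z = d / 2" "P \<bullet> W = d / 2"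
        using XY zw' by (auto simp: P_d inner_add_left frame SV)
      moreover have "midpoint Z W \<bullet> midpoint Z W = 1 / 4"
        using zw' by (simp add: midpoint_def inner_add_left inner_add_right frame)
      moreover have "(dist (midpoint Z W) P)\<^sup>2
        = midpoint Z W \<bullet> midpoint Z W - (P \<bullet> Z + P \<bullet> W) + P \<bullet> P"
        by (simp add: dist_norm power2_norm_eq_inner inner_diff_left inner_diff_right inner_commute
            midpoint_def inner_add_left inner_add_right)
      ultimately have PP2: "P \<bullet> P = 1 / 2 + d"
        unfolding P(2) by (simp add: power_divide)
      \<comment> \<open>Compare \<open>PP1\<close> with \<open>PP2\<close>: if
        \<open>a^2 + b^2 > 1\<close>, then also \<open>a + b > 1\<close>, and \<open>PP1\<close>
        exceeds \<open>1 / 2 + d\<close>.\<close>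
      have "a\<^sup>2 + b\<^sup>2 \<le> 1"
      proof (rule ccontr)
        assume "\<not> a\<^sup>2 + b\<^sup>2 \<le> 1"
        then have gt: "1 < a\<^sup>2 + b\<^sup>2" by simp
        also have "\<dots> \<le> (a + b)\<^sup>2" using ab by (simp add: power2_sum)
        finally have "1\<^sup>2 < (a + b)\<^sup>2" by simp
        then have "1 < a + b" by (rule power_less_imp_less_base) (use ab in simp)
        then have "d * 1 \<le> d * (a + b)" using d by (intro mult_left_mono) auto
        moreover have "1 / 2 < (a\<^sup>2 + b\<^sup>2) / 2" using gt by simp
        moreover have "0 \<le> 2 * d\<^sup>2" by simp
        ultimately have "1 / 2 + d * 1 < (a\<^sup>2 + b\<^sup>2) / 2 + d * (a + b) + 2 * d\<^sup>2"
          by (meson add_less_le_mono add_increasing2 less_le_trans order_refl)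
        then show False using PP1 PP2 by simp
      qed
      from lift[OF XY ab(1,2) this]
      have l: "(H + 4 * t\<^sup>2 - 1) / 2 \<le> a * (h X + t) + b * (h Y + t)" .
      \<comment> \<open>This is where \<open>1/4 <= t\<close> enters: moving a centre along
        \<open>S\<close> by \<open>d\<close> relaxes the constraint by this amount.\<close>
      have "0 \<le> d * (4 * t - 1)" using d t by simp
      have qq: "q \<bullet> q = H / 2 + 2 * t\<^sup>2"
        using xS by (simp add: q_def inner_add_left inner_add_right xx SS inner_commute
            power2_eq_square)
      have qP: "q \<bullet> P = (a * (h X + t) + b * (h Y + t) + 4 * d * t) / 2"
        using XY xS by (simp add: q_def P_d inner_add_left inner_add_right SV SS h_def field_simps)
      have "(dist P q)\<^sup>2 = q \<bullet> q - 2 * (q \<bullet> P) + P \<bullet> P"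
        by (simp add: dist_norm power2_norm_eq_inner inner_diff_left inner_diff_right inner_commute)
      also have "\<dots> \<le> 1\<^sup>2"
        using l \<open>0 \<le> d * (4 * t - 1)\<close> unfolding qq qP PP2 by (simp add: field_simps)
      finally have "dist P q \<le> 1" by (rule power2_le_imp_le) simp
      then show "q \<in> cball P 1" by simp
    qed
    moreover have "\<pi> q = x" by (simp add: \<pi> q_def inner_add_left xS SS)
    ultimately show ?thesis by blast
  qed
  ultimately show ?thesis unfolding \<pi>_def V_def by blast
qed

end
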